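(* Let $0\le n\le N-1$ and let $u^n$ and $u^{n+1}$ be the discrete DLR solutions at times $t_n$, $t_{n+1}$ produced by the scheme described in the context, and assume that $\tilde M^{n+1}=(\langle \tilde U^{n+1}_i,\tilde U^{n+1}_j\rangle_H)_{i,j=1}^R$ has full rank. Then $$\Big\langle \frac{u^{n+1}-u^n}{\triangle t},v_h\Big\rangle_{H,\hat\rho}+\big(\mathcal L(u^n,u^{n+1}),v_h\big)_{V'V,\hat\rho}=\langle f^{n,n+1},v_h\rangle_{H,\hat\rho}$$ for all $v_h=\bar v_h+v_h^*$ with $\bar v_h\in V_h$ and $v_h^*\in\mathcal T_{\tilde U^{n+1}(Y^n)^{\intercal}}\mathcal M_R^{h,\hat\rho}$.
   Context: Setting. $V,H$ are separable real Hilbert spaces forming a Gelfand triple $V\subset H\subset V'$ ($V$ dense and continuously embedded in $H$); $(\cdot,\cdot)_{V'V}$ is the duality pairing, extending $\langle\cdot,\cdot\rangle_H$. $\hat\Gamma=\{\omega_1,\dots,\omega_{\hat N}\}$ is a finite set of points with weights $\lambda_k>0$, $\sum_k\lambda_k=1$, and $\hat\rho=\sum_k\lambda_k\delta_{\omega_k}$. $L^2_{\hat\rho}$ is the space of real functions on $\hat\Gamma$ with $\langle v,w\rangle_{L^2_{\hat\rho}}=\sum_k\lambda_kv(\omega_k)w(\omega_k)$; $\mathbb E_{\hat\rho}[v]=\sum_k\lambda_kv(\omega_k)$ (also for vector-valued $v$); $L^2_{\hat\rho,0}=\{v\in L^2_{\hat\rho}:\mathbb E_{\hat\rho}[v]=0\}$;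 $v^*:=v-\mathbb E_{\hat\rho}[v]$. For functions on $\hat\Gamma$ with values in $H$ put $\langle v,w\rangle_{H,\hat\rho}=\sum_k\lambda_k\langle v(\omega_k),w(\omega_k)\rangle_H$, and for $\mathcal K:\hat\Gamma\to V'$, $v:\hat\Gamma\to V$ put $(\mathcal K,v)_{V'V,\hat\rho}=\sum_k\lambda_k(\mathcal K(\omega_k),v(\omega_k))_{V'V}$. $V_h\subset V$ is a finite-dimensional subspace with $\dim V_h>R$, $R<\hat N$; $V_h\otimes L^2_{\hat\rho}$ (resp. $V_h\otimes L^2_{\hat\rho,0}$) is identified with the functions $\hat\Gamma\to V_h$ (resp. those of zero mean). $\triangle t=T/N$, $t_n=n\triangle t$. The random linear operator $L(\omega):V\to V'$, $\omega\in\hat\Gamma$, is uniformly bounded and coercive, $\mathcal L(u)(\omega)=L(\omega)u(\omega)$. $\mathcal L(u^n,u^{n+1}):\hat\Gamma\to V'$ and $f^{n,n+1}:\hat\Gamma\to H$ stand for an unspecified time integration of $\mathcal L(u(t))$ and of the right-hand side $f(t)$ over $[t_n,t_{n+1}]$ (for example $\mathcal L(u^n)$ or $\mathcal L(u^{n+1})$). Scheme (one step, from $u^n$ to $u^{n+1}$). Given $u^n=\bar u^n+\sum_{j=1}^RU^n_jY^n_j$ with $\bar u^n,U^n_j\in V_h$, $Y^n_j\in L^2_{\hat\rho}$, $\langle Y^n_i,Y^n_j\rangle_{L^2_{\hat\rho}}=\delta_{ij}$, $\mathbb E_{\hat\rho}[Y^n_j]=0$; write $U=(U_1,\dots,U_R)$,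 $Y=(Y_1,\dots,Y_R)$ (rows), so $UY^{\intercal}=\sum_jU_jY_j$, and $G:=\mathcal L(u^n,u^{n+1})-f^{n,n+1}$. 1. $\bar u^{n+1}\in V_h$: $\langle\frac{\bar u^{n+1}-\bar u^n}{\triangle t},v_h\rangle_H+(\mathbb E_{\hat\rho}[G],v_h)_{V'V}=0$ for all $v_h\in V_h$. 2. $\tilde U^{n+1}_j\in V_h$: $\langle\frac{\tilde U^{n+1}_j-U^n_j}{\triangle t},v_h\rangle_H+(\mathbb E_{\hat\rho}[G\,Y^n_j],v_h)_{V'V}=0$ for all $v_h\in V_h$, $j=1,\dots,R$. 3. $\tilde Y^{n+1}\in(L^2_{\hat\rho})^R$: $\frac{\tilde Y^{n+1}-Y^n}{\triangle t}\tilde M^{n+1}+\mathcal P^\perp_{\hat\rho,\mathcal Y^n}\big[(G^*,\tilde U^{n+1})_{V'V}\big]=0$, where $(G^*,\tilde U^{n+1})_{V'V}$ is the row $((G^*,\tilde U^{n+1}_j)_{V'V})_j$ of elements of $L^2_{\hat\rho}$ and $\mathcal P^\perp_{\hat\rho,\mathcal Y^n}$ is the $L^2_{\hat\rho}$-orthogonal projection onto the orthogonal complement of $\mathcal Y^n=\mathrm{span}\{Y^n_1,\dots,Y^n_R\}$. 4. Reorthonormalize: $(U^{n+1},Y^{n+1})$ with $\sum_jY^{n+1}_jU^{n+1}_j=\sum_j\tilde Y^{n+1}_j\tilde U^{n+1}_j$ and $\langle Y^{n+1}_i,Y^{n+1}_j\rangle_{L^2_{\hat\rho}}=\delta_{ij}$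 (and zero-mean $Y^{n+1}_j$). 5. $u^{n+1}=\bar u^{n+1}+\sum_jU^{n+1}_jY^{n+1}_j$. A solution of the scheme is assumed to exist. Discrete manifold and tangent space. $\mathcal M^{h,\hat\rho}_R$ is the set of $\sum_{i=1}^RU_iY_i$ with $U_1,\dots,U_R\in V_h$ linearly independent and $Y_i\in L^2_{\hat\rho,0}$, $\langle Y_i,Y_j\rangle_{L^2_{\hat\rho}}=\delta_{ij}$. For $UY^{\intercal}\in\mathcal M^{h,\hat\rho}_R$, $$\mathcal T_{UY^{\intercal}}\mathcal M^{h,\hat\rho}_R=\Big\{\sum_{i=1}^R(U_i\,\delta Y_i+\delta U_i\,Y_i):\ \delta U_i\in V_h,\ \delta Y_i\in L^2_{\hat\rho,0},\ \langle\delta Y_i,Y_j\rangle_{L^2_{\hat\rho}}=0\ \forall i,j\Big\}.$$ *)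

theory Defs
  imports "HOL-Analysis.Analysis"
begin

(* Conventions.
   The Hilbert space V is the type 'v, H is 'h; V' is the type 'v \<Rightarrow>\<^sub>L real of bounded linear
   functionals, so the duality pairing is blinfun_apply.  V is placed in H by an injective
   bounded operator emb.  The finite point set is the finite type 'w, weighted by lam;
   functions on it are plain functions.  The rank is R = CARD('r). *)

definition gelfand_triple ::
    "('v::{real_inner,complete_space} \<Rightarrow>\<^sub>L 'h::{real_inner,complete_space}) \<Rightarrow> bool" where
  "gelfand_triple emb \<longleftrightarrow>
     separable_space (euclidean :: 'v topology) \<and>
     separable_space (euclidean :: 'h topology) \<and>
     inj (blinfun_apply emb) \<and>
     closure (range (blinfun_apply emb)) = UNIV"

(* The embedding of H into V': h acts as v \<mapsto> \<langle>h, v\<rangle>_H. *)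
definition H_to_dual ::
    "('v::real_inner \<Rightarrow>\<^sub>L 'h::real_inner) \<Rightarrow> 'h \<Rightarrow> ('v \<Rightarrow>\<^sub>L real)" where
  "H_to_dual emb h = blinfun_inner_right h o\<^sub>L emb"

lemma H_to_dual_apply [simp]: "blinfun_apply (H_to_dual emb h) v = h \<bullet> blinfun_apply emb v"
  by (simp add: H_to_dual_def)

definition unif_bounded :: "('w \<Rightarrow> 'v::real_normed_vector \<Rightarrow> 'v \<Rightarrow>\<^sub>L real) \<Rightarrow> bool" where
  "unif_bounded L \<longleftrightarrow> (\<exists>C. \<forall>\<omega> v. norm (L \<omega> v) \<le> C * norm v)"

definition unif_coercive :: "('w \<Rightarrow> 'v::real_normed_vector \<Rightarrow> 'v \<Rightarrow>\<^sub>L real) \<Rightarrow> bool" where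
  "unif_coercive L \<longleftrightarrow> (\<exists>\<alpha>>0. \<forall>\<omega> v. \<alpha> * (norm v)\<^sup>2 \<le> blinfun_apply (L \<omega> v) v)"

definition calL :: "('w \<Rightarrow> 'v \<Rightarrow> 'd) \<Rightarrow> ('w \<Rightarrow> 'v) \<Rightarrow> 'w \<Rightarrow> 'd" where
  "calL L u = (\<lambda>\<omega>. L \<omega> (u \<omega>))"

definition mean :: "('w::finite \<Rightarrow> real) \<Rightarrow> ('w \<Rightarrow> 'a::real_vector) \<Rightarrow> 'a" where
  "mean lam v = (\<Sum>\<omega>\<in>UNIV. lam \<omega> *\<^sub>R v \<omega>)"

definition centred :: "('w::finite \<Rightarrow> real) \<Rightarrow> ('w \<Rightarrow> 'a::real_vector) \<Rightarrow> 'w \<Rightarrow> 'a" where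
  "centred lam v = (\<lambda>\<omega>. v \<omega> - mean lam v)"

(* For 'a = real this is the inner product of L^2, for 'a = 'h that of H-valued functions. *)
definition L2_inner ::
    "('w::finite \<Rightarrow> real) \<Rightarrow> ('w \<Rightarrow> 'a::real_inner) \<Rightarrow> ('w \<Rightarrow> 'a) \<Rightarrow> real" where
  "L2_inner lam v w = (\<Sum>\<omega>\<in>UNIV. lam \<omega> * (v \<omega> \<bullet> w \<omega>))"

definition L2_pairing ::
    "('w::finite \<Rightarrow> real) \<Rightarrow> ('w \<Rightarrow> 'v::real_normed_vector \<Rightarrow>\<^sub>L real) \<Rightarrow> ('w \<Rightarrow> 'v) \<Rightarrow> real" where
  "L2_pairing lam K v = (\<Sum>\<omega>\<in>UNIV. lam \<omega> * blinfun_apply (K \<omega>) (v \<omega>))"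

definition L2_mean_zero :: "('w::finite \<Rightarrow> real) \<Rightarrow> ('w \<Rightarrow> real) set" where
  "L2_mean_zero lam = {v. mean lam v = 0}"

definition L2_orthonormal :: "('w::finite \<Rightarrow> real) \<Rightarrow> ('r \<Rightarrow> 'w \<Rightarrow> real) \<Rightarrow> bool" where
  "L2_orthonormal lam Y \<longleftrightarrow> (\<forall>i j. L2_inner lam (Y i) (Y j) = (if i = j then 1 else 0))"

definition L2_span :: "('r::finite \<Rightarrow> 'w \<Rightarrow> real) \<Rightarrow> ('w \<Rightarrow> real) set" where
  "L2_span Y = {\<lambda>\<omega>. \<Sum>j\<in>UNIV. c j * Y j \<omega> | c. True}"

definition L2_orth_compl :: "('w::finite \<Rightarrow> real) \<Rightarrow> ('w \<Rightarrow> real) set \<Rightarrow> ('w \<Rightarrow> real) set" where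
  "L2_orth_compl lam S = {v. \<forall>s\<in>S. L2_inner lam v s = 0}"

definition L2_proj ::
    "('w::finite \<Rightarrow> real) \<Rightarrow> ('w \<Rightarrow> real) set \<Rightarrow> ('w \<Rightarrow> real) \<Rightarrow> 'w \<Rightarrow> real" where
  "L2_proj lam S v = (THE w. w \<in> S \<and> (\<forall>s\<in>S. L2_inner lam (\<lambda>\<omega>. v \<omega> - w \<omega>) s = 0))"

definition proj_perp ::
    "('w::finite \<Rightarrow> real) \<Rightarrow> ('r::finite \<Rightarrow> 'w \<Rightarrow> real) \<Rightarrow> ('w \<Rightarrow> real) \<Rightarrow> 'w \<Rightarrow> real" where
  "proj_perp lam Y = L2_proj lam (L2_orth_compl lam (L2_span Y))"

definition low_rank :: "('r::finite \<Rightarrow> 'v::real_vector) \<Rightarrow> ('r \<Rightarrow> 'w \<Rightarrow> real) \<Rightarrow> 'w \<Rightarrow> 'v" where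
  "low_rank U Y = (\<lambda>\<omega>. \<Sum>j\<in>UNIV. Y j \<omega> *\<^sub>R U j)"

definition dlr_fun ::
    "'v::real_vector \<Rightarrow> ('r::finite \<Rightarrow> 'v) \<Rightarrow> ('r \<Rightarrow> 'w \<Rightarrow> real) \<Rightarrow> 'w \<Rightarrow> 'v" where
  "dlr_fun ubar U Y = (\<lambda>\<omega>. ubar + low_rank U Y \<omega>)"

definition gram :: "('v::real_inner \<Rightarrow>\<^sub>L 'h::real_inner) \<Rightarrow> ('r \<Rightarrow> 'v) \<Rightarrow> real^'r^'r" where
  "gram emb U = (\<chi> i j. blinfun_apply emb (U i) \<bullet> blinfun_apply emb (U j))"

definition manifold_factors ::
    "('w::finite \<Rightarrow> real) \<Rightarrow> 'v::real_vector set \<Rightarrow> ('r::finite \<Rightarrow> 'v) \<Rightarrow> ('r \<Rightarrow> 'w \<Rightarrow> real) \<Rightarrow> bool"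
  where
  "manifold_factors lam Vh U Y \<longleftrightarrow>
     (\<forall>i. U i \<in> Vh) \<and> inj U \<and> independent (range U) \<and>
     (\<forall>i. Y i \<in> L2_mean_zero lam) \<and> L2_orthonormal lam Y"

definition dlr_manifold ::
    "'r::finite itself \<Rightarrow> ('w::finite \<Rightarrow> real) \<Rightarrow> 'v::real_vector set \<Rightarrow> ('w \<Rightarrow> 'v) set" where
  "dlr_manifold _ lam Vh =
     {low_rank U Y | (U :: 'r \<Rightarrow> 'v) Y. manifold_factors lam Vh U Y}"

(* The tangent space at low_rank U Y, written, as usual, through the factors U and Y;
   meaningful when manifold_factors lam Vh U Y holds. *)
definition tangent_space ::
    "('w::finite \<Rightarrow> real) \<Rightarrow> 'v::real_vector set \<Rightarrow> ('r::finite \<Rightarrow> 'v) \<Rightarrow> ('r \<Rightarrow> 'w \<Rightarrow> real)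
     \<Rightarrow> ('w \<Rightarrow> 'v) set" where
  "tangent_space lam Vh U Y =
     {\<lambda>\<omega>. \<Sum>i\<in>UNIV. dY i \<omega> *\<^sub>R U i + Y i \<omega> *\<^sub>R dU i | dU dY.
        (\<forall>i. dU i \<in> Vh) \<and> (\<forall>i. dY i \<in> L2_mean_zero lam) \<and>
        (\<forall>i j. L2_inner lam (dY i) (Y j) = 0)}"

(* One step from index n to n + 1, in the order: old data, mean, deterministic modes,
   stochastic modes, reorthonormalization.
   LL u u' is the time integration of calL L u over the
   step and f the one of the right-hand side.  U~^(n+1), Y~^(n+1) are Ut (Suc n), Yt (Suc n). *)
definition dlr_step ::
    "('v::{real_inner,complete_space} \<Rightarrow>\<^sub>L 'h::{real_inner,complete_space}) \<Rightarrow>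
     ('w::finite \<Rightarrow> real) \<Rightarrow> 'v set \<Rightarrow> real \<Rightarrow>
     (('w \<Rightarrow> 'v) \<Rightarrow> ('w \<Rightarrow> 'v) \<Rightarrow> 'w \<Rightarrow> 'v \<Rightarrow>\<^sub>L real) \<Rightarrow> ('w \<Rightarrow> 'h) \<Rightarrow>
     (nat \<Rightarrow> 'v) \<Rightarrow> (nat \<Rightarrow> 'r::finite \<Rightarrow> 'v) \<Rightarrow> (nat \<Rightarrow> 'r \<Rightarrow> 'w \<Rightarrow> real) \<Rightarrow>
     (nat \<Rightarrow> 'r \<Rightarrow> 'v) \<Rightarrow> (nat \<Rightarrow> 'r \<Rightarrow> 'w \<Rightarrow> real) \<Rightarrow> (nat \<Rightarrow> 'w \<Rightarrow> 'v) \<Rightarrow> nat \<Rightarrow> bool" where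
  "dlr_step emb lam Vh dt LL f ubar U Y Ut Yt u n \<longleftrightarrow>
    (let G = (\<lambda>\<omega>. LL (u n) (u (Suc n)) \<omega> - H_to_dual emb (f \<omega>)) in
     ubar n \<in> Vh \<and> (\<forall>j. U n j \<in> Vh) \<and>
     L2_orthonormal lam (Y n) \<and> (\<forall>j. mean lam (Y n j) = 0) \<and>
     u n = dlr_fun (ubar n) (U n) (Y n) \<and>
     ubar (Suc n) \<in> Vh \<and>
     (\<forall>vh\<in>Vh.
        blinfun_apply emb ((ubar (Suc n) - ubar n) /\<^sub>R dt) \<bullet> blinfun_apply emb vh
        + blinfun_apply (mean lam G) vh = 0) \<and>
     (\<forall>j. Ut (Suc n) j \<in> Vh \<and>
       (\<forall>vh\<in>Vh.
          blinfun_apply emb ((Ut (Suc n) j - U n j) /\<^sub>R dt) \<bullet> blinfun_apply emb vh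
          + blinfun_apply (mean lam (\<lambda>\<omega>. Y n j \<omega> *\<^sub>R G \<omega>)) vh = 0)) \<and>
     (\<forall>j \<omega>.
        (\<Sum>i\<in>UNIV. ((Yt (Suc n) i \<omega> - Y n i \<omega>) / dt) * gram emb (Ut (Suc n)) $ i $ j)
        + proj_perp lam (Y n)
            (\<lambda>\<omega>'. blinfun_apply (centred lam G \<omega>') (Ut (Suc n) j)) \<omega> = 0) \<and>
     low_rank (U (Suc n)) (Y (Suc n)) = low_rank (Ut (Suc n)) (Yt (Suc n)) \<and>
     L2_orthonormal lam (Y (Suc n)) \<and> (\<forall>j. mean lam (Y (Suc n) j) = 0) \<and>
     u (Suc n) = dlr_fun (ubar (Suc n)) (U (Suc n)) (Y (Suc n)))"

(* The description in L2_proj determines the projection uniquely here. *)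
lemma proj_perp_eq:
  fixes lam :: "'w::finite \<Rightarrow> real" and Y :: "'r::finite \<Rightarrow> 'w \<Rightarrow> real"
  assumes lam: "\<And>\<omega>. lam \<omega> > 0" and Y: "L2_orthonormal lam Y"
  shows "proj_perp lam Y v = (\<lambda>\<omega>. v \<omega> - (\<Sum>j\<in>UNIV. L2_inner lam v (Y j) * Y j \<omega>))"
    (is "_ = ?w")
proof -
  have lin: "L2_inner lam (\<lambda>\<omega>. \<Sum>j\<in>UNIV. c j * Y j \<omega>) s = (\<Sum>j\<in>UNIV. c j * L2_inner lam (Y j) s)"
    for c :: "'r \<Rightarrow> real" and s
    unfolding L2_inner_def
    by (simp add: sum_distrib_left sum_distrib_right, subst sum.swap, simp add: ac_simps)
  have dif: "L2_inner lam (\<lambda>\<omega>. a \<omega> - b \<omega>) s = L2_inner lam a s - L2_inner lam b s"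
    for a b s :: "'w \<Rightarrow> real"
    by (simp add: L2_inner_def algebra_simps sum_subtractf)
  have sym: "L2_inner lam a b = L2_inner lam b a" for a b :: "'w \<Rightarrow> real"
    by (simp add: L2_inner_def mult.commute)
  have pos: "a = (\<lambda>_. 0)" if "L2_inner lam a a = 0" for a :: "'w \<Rightarrow> real"
  proof
    fix \<omega>
    have "\<forall>\<omega>\<in>UNIV. lam \<omega> * (a \<omega> \<bullet> a \<omega>) = 0"
      using that unfolding L2_inner_def
      by (subst (asm) sum_nonneg_eq_0_iff) (auto intro: mult_nonneg_nonneg less_imp_le[OF lam])
    then have "lam \<omega> * (a \<omega> \<bullet> a \<omega>) = 0" by blast
    then show "a \<omega> = 0" using lam[of \<omega>] by simp
  qed
  define S where "S = L2_orth_compl lam (L2_span Y)"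
  have S_iff: "a \<in> S \<longleftrightarrow> (\<forall>j. L2_inner lam (Y j) a = 0)" for a
  proof
    assume a: "a \<in> S"
    show "\<forall>j. L2_inner lam (Y j) a = 0"
    proof
      fix j
      have "Y j = (\<lambda>\<omega>. \<Sum>i\<in>UNIV. (if i = j then 1 else 0) * Y i \<omega>)"
        by (auto simp: if_distrib[of "\<lambda>x. x * _"] cong: if_cong)
      then have "Y j \<in> L2_span Y" unfolding L2_span_def mem_Collect_eq
        by (intro exI[of _ "\<lambda>i. if i = j then 1 else 0"] conjI TrueI)
      then show "L2_inner lam (Y j) a = 0"
        using a sym unfolding S_def L2_orth_compl_def by auto
    qed
  next
    assume "\<forall>j. L2_inner lam (Y j) a = 0"
    then show "a \<in> S"
      unfolding S_def L2_orth_compl_def L2_span_def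
      by (auto simp: sym[of a] lin)
  qed
  have w: "?w \<in> S"
    unfolding S_iff
  proof
    fix i
    have "L2_inner lam (Y i) ?w = L2_inner lam ?w (Y i)" by (rule sym)
    also have "\<dots> = L2_inner lam v (Y i)
        - (\<Sum>j\<in>UNIV. L2_inner lam v (Y j) * L2_inner lam (Y j) (Y i))"
      by (simp only: dif lin)
    also have "\<dots> = 0"
    proof -
      have "L2_inner lam v (Y j) * L2_inner lam (Y j) (Y i)
          = (if j = i then L2_inner lam v (Y i) else 0)" for j
        using Y unfolding L2_orthonormal_def by simp
      then show ?thesis by simp
    qed
    finally show "L2_inner lam (Y i) ?w = 0" .
  qed
  have w': "\<forall>s\<in>S. L2_inner lam (\<lambda>\<omega>. v \<omega> - ?w \<omega>) s = 0"
    by (auto simp: lin S_iff)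
  have "(THE w. w \<in> S \<and> (\<forall>s\<in>S. L2_inner lam (\<lambda>\<omega>. v \<omega> - w \<omega>) s = 0)) = ?w"
  proof (rule the_equality)
    show "?w \<in> S \<and> (\<forall>s\<in>S. L2_inner lam (\<lambda>\<omega>. v \<omega> - ?w \<omega>) s = 0)" using w w' by blast
  next
    fix x assume x: "x \<in> S \<and> (\<forall>s\<in>S. L2_inner lam (\<lambda>\<omega>. v \<omega> - x \<omega>) s = 0)"
    define d where "d = (\<lambda>\<omega>. x \<omega> - ?w \<omega>)"
    have "d \<in> S"
    proof -
      have "L2_inner lam (Y i) d = 0" for i
        using x w dif[of x ?w "Y i"] unfolding S_iff d_def by (metis sym diff_self)
      then show ?thesis unfolding S_iff by blast
    qed
    then have "L2_inner lam v d - L2_inner lam x d = 0" "L2_inner lam v d - L2_inner lam ?w d = 0"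
      using x w' dif[of v x d] dif[of v ?w d] by auto
    then have "L2_inner lam d d = 0"
      using dif[of x ?w d] unfolding d_def[symmetric] by simp
    then have "d = (\<lambda>_. 0)" by (rule pos)
    then show "x = ?w" unfolding d_def by (metis eq_iff_diff_eq_0)
  qed
  then show ?thesis unfolding proj_perp_def L2_proj_def S_def .
qed

(* Full rank of the Gram matrix of U~^(n+1) puts U~^(n+1) (Y^n)^T on the manifold. *)
lemma full_rank_manifold_factors:
  fixes U :: "'r::finite \<Rightarrow> 'v::real_inner" and emb :: "'v \<Rightarrow>\<^sub>L 'h::real_inner"
  assumes rk: "rank (gram emb U) = CARD('r)"
    and "\<And>j. U j \<in> Vh" "L2_orthonormal lam Y" "\<And>j. mean lam (Y j) = 0"
  shows "manifold_factors lam Vh U Y" and "low_rank U Y \<in> dlr_manifold TYPE('r) lam Vh"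
proof -
  have ker: "c = 0" if "(\<Sum>j\<in>UNIV. c $ j *\<^sub>R U j) = 0" for c :: "real^'r"
  proof -
    have "(gram emb U *v c) $ i = blinfun_apply emb (U i) \<bullet>
        blinfun_apply emb (\<Sum>j\<in>UNIV. c $ j *\<^sub>R U j)" for i
      by (simp add: gram_def matrix_vector_mult_def blinfun.sum_right blinfun.scaleR_right
          inner_sum_right mult.commute)
    then have "gram emb U *v c = gram emb U *v 0"
      using that by (simp add: vec_eq_iff)
    moreover have "inj ((*v) (gram emb U))" using rk by (simp add: full_rank_injective)
    ultimately show "c = 0" by (rule injD[rotated])
  qed
  have inj: "inj U"
  proof (rule injI, rule ccontr)
    fix i j assume ij: "U i = U j" "i \<noteq> j"
    have "(\<Sum>k\<in>UNIV. (axis i 1 - axis j 1 :: real^'r) $ k *\<^sub>R U k) = 0"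
      using ij by (simp add: axis_def scaleR_left_diff_distrib sum_subtractf
          if_distrib[of "\<lambda>x. x *\<^sub>R _"] cong: if_cong)
    then have "(axis i 1 :: real^'r) = axis j 1" using ker by fastforce
    then show False using ij by (simp add: axis_eq_axis)
  qed
  have "independent (range U)"
  proof (rule independent_if_scalars_zero)
    fix f x assume s: "(\<Sum>x\<in>range U. f x *\<^sub>R x) = 0" and x: "x \<in> range U"
    then obtain i where i: "x = U i" by blast
    have "(\<Sum>j\<in>UNIV. (\<chi> j. f (U j)) $ j *\<^sub>R U j) = 0"
      using s inj by (simp add: sum.reindex)
    then have "(\<chi> j. f (U j)) = 0" by (rule ker)
    then show "f x = 0" unfolding i by (simp add: vec_eq_iff)
  qed simp
  then show "manifold_factors lam Vh U Y"
    using inj assms unfolding manifold_factors_def L2_mean_zero_def by auto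
  then show "low_rank U Y \<in> dlr_manifold TYPE('r) lam Vh" unfolding dlr_manifold_def by blast
qed

end

theory Submission
  imports Defs
begin

text \<open>
  Every admissible test function is a sum of products \<open>d \<cdot> w\<close> of a scalar function and a vector,
  and testing with \<open>d \<cdot> w\<close> amounts to testing the \<open>d\<close>-weighted mean of the scheme with \<open>w\<close>.
  Writing \<open>V\<close>, \<open>Z\<close> for the updated modes before reorthonormalization, split
  \<open>V Z\<^sup>T - U Y\<^sup>T = V (Z - Y)\<^sup>T + (V - U) Y\<^sup>T\<close>.
  Then \<open>d = 1\<close>, \<open>d = Y\<^sub>j\<close> and \<open>d = \<delta>Y\<^sub>j\<close> recover the equations for the mean, the
  deterministic modes and the stochastic modes.  The cross terms vanish because full rank of
  the Gram matrix of \<open>V\<close> makes \<open>(Z - Y) / dt\<close> centred and orthogonal to \<open>Y\<close>.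
\<close>

text \<open>With \<open>D\<close> the difference quotient of the solution and \<open>G\<close> the
  operator minus the right-hand side, its vanishing is the claimed identity tested with
  \<open>v\<close>. Linearity in \<open>v\<close> then reduces everything to products.\<close>

definition weak_residual ::
    "('v::real_inner \<Rightarrow>\<^sub>L 'h::real_inner) \<Rightarrow> ('w::finite \<Rightarrow> real) \<Rightarrow> ('w \<Rightarrow> 'v) \<Rightarrow>
     ('w \<Rightarrow> 'v \<Rightarrow>\<^sub>L real) \<Rightarrow> ('w \<Rightarrow> 'v) \<Rightarrow> real" where
  "weak_residual emb lam D G v =
     L2_inner lam (\<lambda>\<omega>. blinfun_apply emb (D \<omega>)) (\<lambda>\<omega>. blinfun_apply emb (v \<omega>)) + L2_pairing lam G v"

lemma weak_residual_add:
  "weak_residual emb lam D G (\<lambda>\<omega>. v \<omega> + w \<omega>)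
     = weak_residual emb lam D G v + weak_residual emb lam D G w"
  by (simp add: weak_residual_def L2_inner_def L2_pairing_def blinfun.add_right inner_add_right
      distrib_left sum.distrib)

lemma weak_residual_sum:
  "weak_residual emb lam D G (\<lambda>\<omega>. \<Sum>i\<in>I. v i \<omega>) = (\<Sum>i\<in>I. weak_residual emb lam D G (v i))"
proof (induction I rule: infinite_finite_induct)
  case (insert i I)
  then show ?case by (simp add: weak_residual_add)
qed (simp_all add: weak_residual_def L2_inner_def L2_pairing_def blinfun.zero_right)

lemma weak_residual_scaleR:
  "weak_residual emb lam D G (\<lambda>\<omega>. d \<omega> *\<^sub>R w)
     = blinfun_apply emb (mean lam (\<lambda>\<omega>. d \<omega> *\<^sub>R D \<omega>)) \<bullet> blinfun_apply emb w
       + blinfun_apply (mean lam (\<lambda>\<omega>. d \<omega> *\<^sub>R G \<omega>)) w"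
  by (simp add: weak_residual_def L2_inner_def L2_pairing_def mean_def blinfun.sum_right
      blinfun.sum_left blinfun.scaleR_right blinfun.scaleR_left inner_sum_left mult.assoc)

lemma weak_residual_diff_H_to_dual:
  "weak_residual emb lam D (\<lambda>\<omega>. K \<omega> - H_to_dual emb (f \<omega>)) v
     = L2_inner lam (\<lambda>\<omega>. blinfun_apply emb (D \<omega>)) (\<lambda>\<omega>. blinfun_apply emb (v \<omega>))
       + L2_pairing lam K v - L2_inner lam f (\<lambda>\<omega>. blinfun_apply emb (v \<omega>))"
  by (simp add: weak_residual_def L2_inner_def L2_pairing_def blinfun.diff_left
      right_diff_distrib sum_subtractf)

lemma L2_inner_commute: "L2_inner lam v w = L2_inner lam w v"
  by (simp add: L2_inner_def inner_commute)

lemma L2_inner_diff_left: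
  "L2_inner lam (\<lambda>\<omega>. v \<omega> - w \<omega>) s = L2_inner lam v s - L2_inner lam w s"
  by (simp add: L2_inner_def inner_diff_left right_diff_distrib sum_subtractf)

lemma L2_inner_minus_left: "L2_inner lam (\<lambda>\<omega>. - v \<omega>) s = - L2_inner lam v s"
  by (simp add: L2_inner_def sum_negf)

lemma L2_inner_sum_left:
  fixes v :: "'i \<Rightarrow> 'w::finite \<Rightarrow> real"
  shows "L2_inner lam (\<lambda>\<omega>. \<Sum>i\<in>I. c i * v i \<omega>) s = (\<Sum>i\<in>I. c i * L2_inner lam (v i) s)"
  unfolding L2_inner_def inner_real_def sum_distrib_left sum_distrib_right
  by (subst sum.swap) (simp add: ac_simps)

lemma mean_real_eq_L2_inner: "mean lam v = L2_inner lam v (\<lambda>_. 1)"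
  for v :: "'w::finite \<Rightarrow> real"
  by (simp add: mean_def L2_inner_def)

text \<open>Meant for the split difference quotient, with \<open>A\<close> the scaled increment of
  the stochastic modes and \<open>B\<close> that of the deterministic modes. Each of the three
  weights \<open>d\<close> used below leaves just one of the three terms.\<close>

lemma mean_scaleR_affine_combination:
  fixes D :: "'w::finite \<Rightarrow> 'v::real_vector" and V B :: "'r::finite \<Rightarrow> 'v"
  assumes "\<And>\<omega>. D \<omega> = a + (\<Sum>i\<in>UNIV. A i \<omega> *\<^sub>R V i) + (\<Sum>i\<in>UNIV. Y i \<omega> *\<^sub>R B i)"
  shows "mean lam (\<lambda>\<omega>. d \<omega> *\<^sub>R D \<omega>) = mean lam d *\<^sub>R a
    + (\<Sum>i\<in>UNIV. L2_inner lam d (A i) *\<^sub>R V i) + (\<Sum>i\<in>UNIV. L2_inner lam d (Y i) *\<^sub>R B i)"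
proof -
  have comb: "(\<Sum>\<omega>\<in>UNIV. lam \<omega> *\<^sub>R d \<omega> *\<^sub>R (\<Sum>i\<in>UNIV. X i \<omega> *\<^sub>R W i))
      = (\<Sum>i\<in>UNIV. L2_inner lam d (X i) *\<^sub>R W i)"
    for X :: "'r \<Rightarrow> 'w \<Rightarrow> real" and W :: "'r \<Rightarrow> 'v"
    unfolding L2_inner_def scaleR_sum_right scaleR_sum_left
    by (subst sum.swap) (simp add: ac_simps)
  show ?thesis
    unfolding mean_def assms scaleR_add_right sum.distrib comb
    by (simp add: scaleR_sum_left)
qed

text \<open>Centring costs only a product of means. It is invisible to a zero-mean \<open>d\<close>,
  and if the weights sum to one it annihilates the constant \<open>d = 1\<close>.\<close>

lemma L2_inner_centred_pairing:
  "L2_inner lam (\<lambda>\<omega>. blinfun_apply (centred lam G \<omega>) w) d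
     = blinfun_apply (mean lam (\<lambda>\<omega>. d \<omega> *\<^sub>R G \<omega>)) w - mean lam d * blinfun_apply (mean lam G) w"
  by (simp add: L2_inner_def centred_def mean_def blinfun.diff_left blinfun.sum_left
      blinfun.scaleR_left left_diff_distrib right_diff_distrib sum_subtractf sum_distrib_right
      mult.assoc mult.commute mult.left_commute)

text \<open>The projection subtracts a combination of the \<open>Y j\<close>, which \<open>s\<close>
  does not see.\<close>

lemma L2_inner_proj_perp:
  fixes Y :: "'r::finite \<Rightarrow> 'w::finite \<Rightarrow> real"
  assumes "\<And>\<omega>. lam \<omega> > 0" and "L2_orthonormal lam Y" and "\<And>j. L2_inner lam (Y j) s = 0"
  shows "L2_inner lam (proj_perp lam Y v) s = L2_inner lam v s"
  using assms by (simp add: proj_perp_eq L2_inner_diff_left L2_inner_sum_left)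

lemma L2_inner_proj_perp_self:
  fixes Y :: "'r::finite \<Rightarrow> 'w::finite \<Rightarrow> real"
  assumes "\<And>\<omega>. lam \<omega> > 0" and "L2_orthonormal lam Y"
  shows "L2_inner lam (proj_perp lam Y v) (Y k) = 0"
proof -
  have "(\<Sum>j\<in>UNIV. L2_inner lam v (Y j) * L2_inner lam (Y j) (Y k)) = L2_inner lam v (Y k)"
    using assms(2) by (simp add: L2_orthonormal_def if_distrib[of "\<lambda>x. _ * x"] cong: if_cong)
  then show ?thesis
    using assms by (simp add: proj_perp_eq L2_inner_diff_left L2_inner_sum_left)
qed

text \<open>By symmetry of the Gram matrix, the hypothesis on columns says that the matrix maps the
  vector \<open>a\<close> to zero, and full rank makes it injective.\<close>

lemma gram_full_rank_cancel:
  fixes U :: "'r::finite \<Rightarrow> 'v::real_inner"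
  assumes "rank (gram emb U) = CARD('r)" and "\<And>j. (\<Sum>i\<in>UNIV. a i * gram emb U $ i $ j) = 0"
  shows "a i = 0"
proof -
  have "(gram emb U *v (\<chi> i. a i)) $ j = (\<Sum>i\<in>UNIV. a i * gram emb U $ i $ j)" for j
    by (simp add: matrix_vector_mult_def gram_def inner_commute mult.commute)
  then have "gram emb U *v (\<chi> i. a i) = gram emb U *v 0"
    using assms(2) by (simp add: vec_eq_iff)
  moreover have "inj ((*v) (gram emb U))" using assms(1) by (simp add: full_rank_injective)
  ultimately have "(\<chi> i. a i) = 0" by (rule injD[rotated])
  then show ?thesis by (simp add: vec_eq_iff)
qed

theorem theorem4p9:
  fixes emb :: "'v::{real_inner,complete_space} \<Rightarrow>\<^sub>L 'h::{real_inner,complete_space}"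
    and lam :: "'w::finite \<Rightarrow> real"
    and Vh :: "'v set"
    and L :: "'w \<Rightarrow> 'v \<Rightarrow> 'v \<Rightarrow>\<^sub>L real"
    and L_int :: "(('w \<Rightarrow> 'v) \<Rightarrow> 'w \<Rightarrow> 'v \<Rightarrow>\<^sub>L real) \<Rightarrow> ('w \<Rightarrow> 'v) \<Rightarrow> ('w \<Rightarrow> 'v) \<Rightarrow> 'w \<Rightarrow> 'v \<Rightarrow>\<^sub>L real"
    and f_int :: "nat \<Rightarrow> 'w \<Rightarrow> 'h"
    and T dt :: real and N n :: nat
    and ubar :: "nat \<Rightarrow> 'v"
    and U Ut :: "nat \<Rightarrow> 'r::finite \<Rightarrow> 'v"
    and Y Yt :: "nat \<Rightarrow> 'r \<Rightarrow> 'w \<Rightarrow> real"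
    and u :: "nat \<Rightarrow> 'w \<Rightarrow> 'v"
  assumes "gelfand_triple emb"
    and "\<And>\<omega>. lam \<omega> > 0" and "(\<Sum>\<omega>\<in>UNIV. lam \<omega>) = 1"
    and "subspace Vh" and "\<exists>B. finite B \<and> span B = Vh"
    and "CARD('r) < dim Vh" and "CARD('r) < CARD('w)"
    and "\<And>\<omega>. linear (L \<omega>)" and "unif_bounded L" and "unif_coercive L"
    and "T > 0" and "dt = T / real N" and "n < N"
    and "dlr_step emb lam Vh dt (L_int (calL L)) (f_int n) ubar U Y Ut Yt u n"
    and "rank (gram emb (Ut (Suc n))) = CARD('r)"
  shows "\<forall>vbar\<in>Vh. \<forall>vstar\<in>tangent_space lam Vh (Ut (Suc n)) (Y n).
    (let vh = (\<lambda>\<omega>. vbar + vstar \<omega>) in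
      L2_inner lam (\<lambda>\<omega>. blinfun_apply emb ((u (Suc n) \<omega> - u n \<omega>) /\<^sub>R dt))
                   (\<lambda>\<omega>. blinfun_apply emb (vh \<omega>))
      + L2_pairing lam (L_int (calL L) (u n) (u (Suc n))) vh
      = L2_inner lam (f_int n) (\<lambda>\<omega>. blinfun_apply emb (vh \<omega>)))"
proof (intro ballI)
  fix vbar vstar
  assume vbar: "vbar \<in> Vh" and "vstar \<in> tangent_space lam Vh (Ut (Suc n)) (Y n)"
  then obtain dU dY where dU: "\<And>i. dU i \<in> Vh" and dY0: "\<And>i. mean lam (dY i) = 0"
    and dYY: "\<And>i j. L2_inner lam (dY i) (Y n j) = 0"
    and vstar: "vstar = (\<lambda>\<omega>. \<Sum>i\<in>UNIV. dY i \<omega> *\<^sub>R Ut (Suc n) i + Y n i \<omega> *\<^sub>R dU i)"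
    unfolding tangent_space_def L2_mean_zero_def by blast
  define G where "G = (\<lambda>\<omega>. L_int (calL L) (u n) (u (Suc n)) \<omega> - H_to_dual emb (f_int n \<omega>))"
  define V where "V = Ut (Suc n)"
  define A where "A = (\<lambda>i \<omega>. (Yt (Suc n) i \<omega> - Y n i \<omega>) / dt)"
  define B where "B = (\<lambda>i. (V i - U n i) /\<^sub>R dt)"
  define a where "a = (ubar (Suc n) - ubar n) /\<^sub>R dt"
  define D where "D = (\<lambda>\<omega>. (u (Suc n) \<omega> - u n \<omega>) /\<^sub>R dt)"
  define p where "p = (\<lambda>j. proj_perp lam (Y n) (\<lambda>\<omega>. blinfun_apply (centred lam G \<omega>) (V j)))"
  have ortho: "L2_orthonormal lam (Y n)" and Y0: "\<And>j. mean lam (Y n j) = 0"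
    and un: "u n = dlr_fun (ubar n) (U n) (Y n)"
    and mean_eq: "\<And>v. v \<in> Vh \<Longrightarrow>
      blinfun_apply emb a \<bullet> blinfun_apply emb v + blinfun_apply (mean lam G) v = 0"
    and det_eq: "\<And>j v. v \<in> Vh \<Longrightarrow> blinfun_apply emb (B j) \<bullet> blinfun_apply emb v
      + blinfun_apply (mean lam (\<lambda>\<omega>. Y n j \<omega> *\<^sub>R G \<omega>)) v = 0"
    and stoch_eq: "\<And>j \<omega>. (\<Sum>i\<in>UNIV. A i \<omega> * gram emb V $ i $ j) + p j \<omega> = 0"
    and reorth: "low_rank (U (Suc n)) (Y (Suc n)) = low_rank V (Yt (Suc n))"
    and uSn: "u (Suc n) = dlr_fun (ubar (Suc n)) (U (Suc n)) (Y (Suc n))"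
    using assms(14)
    unfolding dlr_step_def Let_def G_def[symmetric] V_def[symmetric] A_def B_def a_def p_def
    by blast+

  \<comment> \<open>Adding and subtracting the products of \<open>V i\<close> with the old
    \<open>Y n i\<close> gives the split. By \<open>reorth\<close> the new solution may be written
    with the factors from before reorthonormalization, the only ones that the scheme's equations
    govern.\<close>
  have D: "D \<omega> = a + (\<Sum>i\<in>UNIV. A i \<omega> *\<^sub>R V i) + (\<Sum>i\<in>UNIV. Y n i \<omega> *\<^sub>R B i)" for \<omega>
  proof -
    have "A i \<omega> *\<^sub>R V i + Y n i \<omega> *\<^sub>R B i
        = (Yt (Suc n) i \<omega> *\<^sub>R V i - Y n i \<omega> *\<^sub>R U n i) /\<^sub>R dt" for i
      by (simp add: A_def B_def algebra_simps divide_inverse)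
    then have "(\<Sum>i\<in>UNIV. A i \<omega> *\<^sub>R V i) + (\<Sum>i\<in>UNIV. Y n i \<omega> *\<^sub>R B i)
        = (low_rank V (Yt (Suc n)) \<omega> - low_rank (U n) (Y n) \<omega>) /\<^sub>R dt"
      by (simp add: low_rank_def flip: sum.distrib sum_subtractf scaleR_sum_right)
    then show ?thesis
      unfolding D_def uSn un dlr_fun_def reorth a_def by (simp add: algebra_simps)
  qed
  have stoch: "(\<Sum>i\<in>UNIV. L2_inner lam (A i) s * gram emb V $ i $ j) = - L2_inner lam (p j) s"
    for s j
  proof -
    have "(\<lambda>\<omega>. \<Sum>i\<in>UNIV. gram emb V $ i $ j * A i \<omega>) = (\<lambda>\<omega>. - p j \<omega>)"
    proof
      fix \<omega>
      show "(\<Sum>i\<in>UNIV. gram emb V $ i $ j * A i \<omega>) = - p j \<omega>"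
        using stoch_eq[of \<omega> j] unfolding eq_neg_iff_add_eq_0 by (simp only: mult.commute)
    qed
    then have "L2_inner lam (\<lambda>\<omega>. \<Sum>i\<in>UNIV. gram emb V $ i $ j * A i \<omega>) s
        = L2_inner lam (\<lambda>\<omega>. - p j \<omega>) s"
      by (rule arg_cong)
    then show ?thesis
      unfolding L2_inner_sum_left L2_inner_minus_left by (simp only: mult.commute)
  qed
  \<comment> \<open>For fixed \<open>s\<close>, the products of \<open>s\<close> with the
    \<open>A i\<close> solve a linear system whose matrix is the Gram matrix and whose right-hand
    side comes from the \<open>p j\<close>. Orthogonality thus passes from \<open>p\<close> to
    \<open>A\<close> without inverting the matrix explicitly.\<close>
  have A_orth: "L2_inner lam (A i) s = 0" if "\<And>j. L2_inner lam (p j) s = 0" for i s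
    by (rule gram_full_rank_cancel[OF assms(15)]) (simp add: that stoch flip: V_def)
  have p_test: "L2_inner lam (p j) s
      = blinfun_apply (mean lam (\<lambda>\<omega>. s \<omega> *\<^sub>R G \<omega>)) (V j) - mean lam s * blinfun_apply (mean lam G) (V j)"
    if "\<And>k. L2_inner lam (Y n k) s = 0" for j s
    unfolding p_def L2_inner_proj_perp[OF assms(2) ortho that] by (rule L2_inner_centred_pairing)
  have mean1: "mean lam (\<lambda>_. 1 :: real) = 1" using assms(3) by (simp add: mean_def)
  \<comment> \<open>The constant 1 is orthogonal to every \<open>Y n k\<close> because these have
    zero mean, so \<open>p_test\<close> applies. Its two terms cancel since the weights sum to
    one.\<close>
  have A1: "L2_inner lam (\<lambda>_. 1) (A i) = 0" for i
    unfolding L2_inner_commute[of lam "\<lambda>_. 1"]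
    by (rule A_orth, subst p_test) (simp_all add: mean1 Y0 flip: mean_real_eq_L2_inner)
  \<comment> \<open>Here \<open>G\<close> does not matter: each \<open>p j\<close> lies in the
    orthogonal complement of the old stochastic modes by construction.\<close>
  have YA: "L2_inner lam (Y n j) (A i) = 0" for i j
    unfolding L2_inner_commute[of lam "Y n j"] p_def[symmetric]
    by (rule A_orth) (simp add: p_def L2_inner_proj_perp_self assms(2) ortho)
  have Y1: "L2_inner lam (\<lambda>_. 1) (Y n i) = 0" for i
    using Y0[of i] by (simp add: mean_real_eq_L2_inner L2_inner_commute)
  have YY: "(\<Sum>i\<in>UNIV. L2_inner lam (Y n j) (Y n i) *\<^sub>R B i) = B j" for j
    using ortho by (simp add: L2_orthonormal_def if_distrib[of "\<lambda>x. x *\<^sub>R _"] cong: if_cong)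

  note mean_D = mean_scaleR_affine_combination[of D, OF D]
  have const: "weak_residual emb lam D G (\<lambda>_. vbar) = 0"
    using weak_residual_scaleR[of emb lam D G "\<lambda>_. 1" vbar] mean_eq[OF vbar]
      mean_D[where lam = lam and d = "\<lambda>_. 1"]
    by (simp add: mean1 A1 Y1)
  have det: "weak_residual emb lam D G (\<lambda>\<omega>. Y n i \<omega> *\<^sub>R dU i) = 0" for i
    unfolding weak_residual_scaleR mean_D using det_eq[OF dU] by (simp add: Y0 YA YY)
  \<comment> \<open>The tangent space is taken at the new modes \<open>V\<close>, so pairing the
    surviving sum over \<open>V k\<close> with \<open>V i\<close> yields exactly the Gram matrix
    entries of the stochastic equation. Since \<open>dY i\<close> is orthogonal to the old modes and
    has zero mean, neither the projection nor the centring of \<open>G\<close> leaves a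
    trace.\<close>
  have stochastic: "weak_residual emb lam D G (\<lambda>\<omega>. dY i \<omega> *\<^sub>R V i) = 0" for i
  proof -
    have "blinfun_apply emb (mean lam (\<lambda>\<omega>. dY i \<omega> *\<^sub>R D \<omega>)) \<bullet> blinfun_apply emb (V i)
        = (\<Sum>k\<in>UNIV. L2_inner lam (A k) (dY i) * gram emb V $ k $ i)"
      unfolding mean_D
      by (simp add: dY0 dYY gram_def blinfun.sum_right blinfun.scaleR_right inner_sum_left
          L2_inner_commute[of lam "dY i"])
    also have "\<dots> = - blinfun_apply (mean lam (\<lambda>\<omega>. dY i \<omega> *\<^sub>R G \<omega>)) (V i)"
      using dYY by (simp add: stoch p_test dY0 L2_inner_commute[of lam "Y n _"])
    finally show ?thesis unfolding weak_residual_scaleR by simp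
  qed
  have "weak_residual emb lam D G (\<lambda>\<omega>. vbar + vstar \<omega>) = 0"
    unfolding vstar V_def[symmetric] weak_residual_add weak_residual_sum
    by (simp add: const det stochastic)
  then show "let vh = (\<lambda>\<omega>. vbar + vstar \<omega>) in
      L2_inner lam (\<lambda>\<omega>. blinfun_apply emb ((u (Suc n) \<omega> - u n \<omega>) /\<^sub>R dt))
                   (\<lambda>\<omega>. blinfun_apply emb (vh \<omega>))
      + L2_pairing lam (L_int (calL L) (u n) (u (Suc n))) vh
      = L2_inner lam (f_int n) (\<lambda>\<omega>. blinfun_apply emb (vh \<omega>))"
    unfolding G_def weak_residual_diff_H_to_dual D_def Let_def by simp
qed

end
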